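(* For every positive integer $k$, there is a connected graph $G$ of girth at least $k$ and minimum degree at least $k$ such that $\alpha_b(G)\ge 2\left(1-\frac{1}{k}\right)\alpha(G)$.
   Context: All graphs are finite, simple and undirected. $\alpha(G)$ is the independence number of $G$. For a connected graph $G$, an independent broadcast on $G$ is a function $f:V(G)\to\{0,1,2,\dots\}$ such that (B1) $f(x)\le \mathrm{ecc}_G(x)$ for every vertex $x$, where $\mathrm{ecc}_G(x)$ is the eccentricity of $x$ in $G$, and (B2) $\mathrm{dist}_G(x,y)>\max\{f(x),f(y)\}$ for every two distinct vertices $x,y$ with $f(x),f(y)>0$. The weight of $f$ is $\sum_{x\in V(G)}f(x)$, and the broadcast independence number $\alpha_b(G)$ is the maximum weight of an independent broadcast on $G$. The girth of a graph is the length of a shortest cycle (infinite if the graph is acyclic). *)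

theory Defs
  imports "Graph_Theory.Graph_Theory" "HOL-Library.Extended_Nat"
begin

text \<open>
  A finite simple undirected graph is a \<^locale>\<open>pair_graph\<close>: an undirected edge is represented by
  its two opposite arcs. In such a graph the neighbours of a vertex correspond to its outgoing arcs,
  so that \<^const>\<open>out_degree\<close> is the degree.
\<close>

definition min_degree :: "('a, 'b) pre_digraph \<Rightarrow> nat" where
  "min_degree G = Min (out_degree G ` verts G)"

text \<open>
  \<^const>\<open>pre_digraph.cycle\<close> also admits the closed walk of length 2 along an edge and back, which is
  not a cycle of the undirected graph. The infimum of the empty set is \<open>\<infinity>\<close>.
\<close>

definition girth :: "('a, 'b) pre_digraph \<Rightarrow> enat" where
  "girth G = (INF p \<in> {p. pre_digraph.cycle G p \<and> 3 \<le> length p}. enat (length p))"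

definition graph_dist :: "('a, 'b) pre_digraph \<Rightarrow> 'a \<Rightarrow> 'a \<Rightarrow> enat" where
  "graph_dist G u v = (INF p \<in> {p. pre_digraph.awalk G u p v}. enat (length p))"

definition eccentricity :: "('a, 'b) pre_digraph \<Rightarrow> 'a \<Rightarrow> enat" where
  "eccentricity G u = (SUP v \<in> verts G. graph_dist G u v)"

definition independent_vertices :: "('a, 'b) pre_digraph \<Rightarrow> 'a set \<Rightarrow> bool" where
  "independent_vertices G S \<longleftrightarrow>
     S \<subseteq> verts G \<and> (\<forall>u \<in> S. \<forall>v \<in> S. \<not> u \<rightarrow>\<^bsub>G\<^esub> v)"

definition independence_number :: "('a, 'b) pre_digraph \<Rightarrow> nat" where
  "independence_number G = Max {card S | S. independent_vertices G S}"

definition independent_broadcast :: "('a, 'b) pre_digraph \<Rightarrow> ('a \<Rightarrow> nat) \<Rightarrow> bool" where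
  "independent_broadcast G f \<longleftrightarrow>
     (\<forall>x \<in> verts G. enat (f x) \<le> eccentricity G x) \<and>
     (\<forall>x \<in> verts G. \<forall>y \<in> verts G.
        x \<noteq> y \<and> f x > 0 \<and> f y > 0 \<longrightarrow> graph_dist G x y > enat (max (f x) (f y)))"

definition broadcast_weight :: "('a, 'b) pre_digraph \<Rightarrow> ('a \<Rightarrow> nat) \<Rightarrow> nat" where
  "broadcast_weight G f = (\<Sum>x \<in> verts G. f x)"

text \<open>
  Meaningful for finite connected graphs only: there eccentricities are finite, and hence so is the
  set of weights.
\<close>

definition broadcast_independence_number :: "('a, 'b) pre_digraph \<Rightarrow> nat" where
  "broadcast_independence_number G = Max {broadcast_weight G f | f. independent_broadcast G f}"

end

theory Submission
  imports Defs
begin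

text \<open>
  Take disjoint stars with centers \<open>X\<close> and \<open>k\<close> leaves each, let \<open>R\<close> be the set of all leaves, and add
  edges inside \<open>R\<close> only. Any two centers then stay at distance at least 3, so the value 2 on \<open>X\<close> and 0
  on \<open>R\<close> is an independent broadcast of weight \<open>2 * card X\<close>. If no \<open>s\<close>-subset of \<open>R\<close> is independent,
  where \<open>card X = (k - 1) * s\<close>, the independence number is at most \<open>card X + s\<close>, which is the claim.

  The edges are found greedily. In a graph of maximum degree at most \<open>d\<close> with linearly many edges, few
  vertices have degree \<open>d\<close> and few vertices are near a given one. Hence a constant fraction of the
  pairs inside any \<open>s\<close>-set can be joined without creating a short cycle or a degree above \<open>d\<close>, and some
  pair destroys a constant fraction of all independent \<open>s\<close>-sets. There are at most \<open>2 ^ card R\<close> such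
  sets, so \<open>O(card R)\<close> steps destroy them all. The same greedy step raises the degrees in \<open>R\<close> to \<open>k\<close>, and
  an edge joining two components creates no cycle.
\<close>

section \<open>Walks, short cycles and adding an edge\<close>

text \<open>The usual notion for symmetric irreflexive \<open>E\<close>: a cycle of length \<open>l + 1\<close> is an edge whose ends
  are joined by a walk of length \<open>l\<close> avoiding it.\<close>

definition no_short_cycle :: "nat \<Rightarrow> 'a rel \<Rightarrow> bool" where
  "no_short_cycle k E \<longleftrightarrow>
     (\<forall>u v l. (u, v) \<in> E \<and> l + 1 < k \<longrightarrow> (u, v) \<notin> (E - {(u, v), (v, u)}) ^^ l)"

text \<open>The open ball of radius \<open>k\<close>. For \<open>k \<ge> 2\<close> it contains
  \<open>u\<close> and its neighbours, so a vertex outside it can be joined to \<open>u\<close>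
  without a loop or a repeated edge.\<close>

definition near :: "nat \<Rightarrow> 'a rel \<Rightarrow> 'a \<Rightarrow> 'a set" where
  "near k E u = {v. \<exists>l<k. (u, v) \<in> E ^^ l}"

definition add_edge :: "'a \<Rightarrow> 'a \<Rightarrow> 'a rel \<Rightarrow> 'a rel" where
  "add_edge a b E = E \<union> {(a, b), (b, a)}"

lemma sym_relpow: "sym E \<Longrightarrow> sym (E ^^ l)"
proof (induction l)
  case (Suc l)
  then show ?case
    using relpow_commute[of E l] by (simp add: sym_conv_converse_eq converse_relcomp)
qed (simp add: sym_Id)

lemma relpow_mono_rel:
  fixes A B :: "'a rel"
  shows "A \<subseteq> B \<Longrightarrow> (x, y) \<in> A ^^ l \<Longrightarrow> (x, y) \<in> B ^^ l"
  by (induction l arbitrary: y) auto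

text \<open>A walk can be shortened until it uses the new edge at most once. In the induction, if
  the last step is the new edge, the earlier part already gives an \<open>E\<close>-walk from
  \<open>u\<close> to one of \<open>a\<close>, \<open>b\<close>; if that end is \<open>v\<close>
  itself, the walk stops there.\<close>

lemma relpow_add_edgeD:
  assumes "(u, v) \<in> (add_edge a b E) ^^ l"
  shows "(\<exists>i\<le>l. (u, v) \<in> E ^^ i)
    \<or> (\<exists>i j. i + j < l \<and> (u, a) \<in> E ^^ i \<and> (b, v) \<in> E ^^ j)
    \<or> (\<exists>i j. i + j < l \<and> (u, b) \<in> E ^^ i \<and> (a, v) \<in> E ^^ j)"
  using assms
proof (induction l arbitrary: v)
  case (Suc l)
  then obtain w where w: "(u, w) \<in> (add_edge a b E) ^^ l" "(w, v) \<in> add_edge a b E"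
    by auto
  note IH = Suc.IH[OF w(1)]
  consider "(w, v) \<in> E" | "w = a" "v = b" | "w = b" "v = a"
    using w(2) by (auto simp: add_edge_def)
  then show ?case
  proof cases
    case 1
    have ext: "(x, v) \<in> E ^^ Suc i" if "(x, w) \<in> E ^^ i" for x i
      using that 1 by auto
    from IH consider i where "i \<le> l" "(u, w) \<in> E ^^ i"
      | i j where "i + j < l" "(u, a) \<in> E ^^ i" "(b, w) \<in> E ^^ j"
      | i j where "i + j < l" "(u, b) \<in> E ^^ i" "(a, w) \<in> E ^^ j"
      by blast
    then show ?thesis
    proof cases
      case (1 i)
      then show ?thesis using ext[of u i] by (meson Suc_le_mono)
    next
      case (2 i j)
      then have "i + Suc j < Suc l" by simp
      with 2 ext[of b j] show ?thesis by meson
    next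
      case (3 i j)
      then have "i + Suc j < Suc l" by simp
      with 3 ext[of a j] show ?thesis by meson
    qed
  next
    case 2
    have "(b, b) \<in> E ^^ 0" by simp
    moreover have "\<exists>i\<le>l. (u, a) \<in> E ^^ i \<or> (u, b) \<in> E ^^ i"
      using IH 2 by (meson add_leD1 less_imp_le)
    ultimately show ?thesis
      using 2 by (metis add.right_neutral le_SucI le_imp_less_Suc)
  next
    case 3
    have "(a, a) \<in> E ^^ 0" by simp
    moreover have "\<exists>i\<le>l. (u, a) \<in> E ^^ i \<or> (u, b) \<in> E ^^ i"
      using IH 3 by (meson add_leD1 less_imp_le)
    ultimately show ?thesis
      using 3 by (metis add.right_neutral le_SucI le_imp_less_Suc)
  qed
qed auto

text \<open>A short cycle through the new edge would contain an \<open>E\<close>-walk of fewer than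
  \<open>k\<close> steps between \<open>a\<close> and \<open>b\<close>.\<close>

lemma no_short_cycle_add_edge:
  assumes E: "no_short_cycle k E" "sym E" and far: "b \<notin> near k E a"
  shows "no_short_cycle k (add_edge a b E)"
  unfolding no_short_cycle_def
proof (intro allI impI, elim conjE)
  fix u v l
  assume uv: "(u, v) \<in> add_edge a b E" and l: "l + 1 < k"
  have ab: "(a, b) \<notin> E ^^ i" "(b, a) \<notin> E ^^ i" if "i < k" for i
    using far that sym_relpow[OF E(2), of i] by (auto simp: near_def dest: symD)
  let ?E = "E - {(u, v), (v, u)}"
  show "(u, v) \<notin> (add_edge a b E - {(u, v), (v, u)}) ^^ l"
  proof (cases "(u, v) = (a, b) \<or> (u, v) = (b, a)")
    case True
    then have "add_edge a b E - {(u, v), (v, u)} \<subseteq> E" by (auto simp: add_edge_def)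
    then show ?thesis
      using True ab[of l] l by (auto dest: relpow_mono_rel)
  next
    case False
    then have uvE: "(u, v) \<in> E" "(v, u) \<in> E" using uv E(2) by (auto simp: add_edge_def dest: symD)
    have eq: "add_edge a b E - {(u, v), (v, u)} = add_edge a b ?E"
      using False by (auto simp: add_edge_def)
    \<comment> \<open>Rotating the closed walk: from \<open>y\<close> to \<open>v\<close>, over the
      old edge to \<open>u\<close>, and on to \<open>x\<close>, in \<open>i + j + 1 \<le> l\<close>
      steps of \<open>E\<close>. As \<open>l < k\<close>, the ends of the new edge would be near
      each other.\<close>
    have loop: False if "i + j < l" "(u, x) \<in> ?E ^^ i" "(y, v) \<in> ?E ^^ j" 
      "(x, y) \<in> {(a, b), (b, a)}" for i j x y
    proof -
      have "(y, v) \<in> E ^^ j" "(u, x) \<in> E ^^ i"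
        using that relpow_mono_rel[of ?E E] by auto
      then have "(y, x) \<in> E ^^ (Suc j + i)"
        using uvE(2) by (auto simp: relpow_add simp del: add_Suc)
      then show False using ab[of "Suc j + i"] that(1,4) l by auto
    qed
    show ?thesis
    proof
      assume "(u, v) \<in> (add_edge a b E - {(u, v), (v, u)}) ^^ l"
      then have "(u, v) \<in> add_edge a b ?E ^^ l" by (simp only: eq)
      from relpow_add_edgeD[OF this] consider i where "i \<le> l" "(u, v) \<in> ?E ^^ i"
        | i j where "i + j < l" "(u, a) \<in> ?E ^^ i" "(b, v) \<in> ?E ^^ j"
        | i j where "i + j < l" "(u, b) \<in> ?E ^^ i" "(a, v) \<in> ?E ^^ j"
        by blast
      then show False
      proof cases
        case 1
        then show False using E(1) uvE l unfolding no_short_cycle_def by (meson add_le_mono1 le_less_trans)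
      qed (use loop in blast)+
    qed
  qed
qed

section \<open>Sizes of balls and number of saturated vertices\<close>

lemma card_relpow_Image_le:
  fixes E :: "'a rel"
  assumes "finite E" "\<And>v. card (E `` {v}) \<le> d"
  shows "finite ((E ^^ l) `` {u}) \<and> card ((E ^^ l) `` {u}) \<le> d ^ l"
proof (induction l)
  case (Suc l)
  have eq: "(E ^^ Suc l) `` {u} = (\<Union>w\<in>(E ^^ l) `` {u}. E `` {w})" by auto
  have fin: "finite (E `` {w})" for w using assms(1) by (simp add: finite_Image)
  have "card ((E ^^ Suc l) `` {u}) \<le> (\<Sum>w\<in>(E ^^ l) `` {u}. card (E `` {w}))"
    unfolding eq using Suc by (intro card_UN_le) auto
  also have "\<dots> \<le> card ((E ^^ l) `` {u}) * d"
    using sum_bounded_above[of "(E ^^ l) `` {u}" "\<lambda>w. card (E `` {w})" d] assms(2) by simp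
  also have "\<dots> \<le> d ^ Suc l" using Suc by (simp add: mult.commute)
  finally show ?case unfolding eq using Suc fin by auto
qed auto

lemma near_bound:
  assumes "finite E" "\<And>v. card (E `` {v}) \<le> d" "d \<ge> 1"
  shows "finite (near k E u)" "card (near k E u) \<le> k * d ^ k"
proof -
  have eq: "near k E u = (\<Union>l<k. (E ^^ l) `` {u})" by (auto simp: near_def)
  note b = card_relpow_Image_le[OF assms(1,2)]
  show "finite (near k E u)" unfolding eq using b by auto
  have "card (near k E u) \<le> (\<Sum>l<k. card ((E ^^ l) `` {u}))"
    unfolding eq by (intro card_UN_le) auto
  also have "\<dots> \<le> (\<Sum>l<k. d ^ k)"
    using b assms(3) by (intro sum_mono) (meson le_trans lessThan_iff less_imp_le power_increasing)
  finally show "card (near k E u) \<le> k * d ^ k" by simp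
qed

text \<open>When degrees are bounded by \<open>d\<close>, these are the vertices that can take no
  further edge.\<close>

definition saturated :: "nat \<Rightarrow> 'a rel \<Rightarrow> 'a set" where
  "saturated d E = {v. d \<le> card (E `` {v})}"

text \<open>The degrees sum to \<open>card E\<close>, which counts both arcs of an edge. Since
  \<open>d \<ge> 1\<close>, saturated vertices lie in the finite set
  \<open>Domain E\<close>.\<close>

lemma card_saturated:
  assumes "finite E" "d \<ge> 1"
  shows "finite (saturated d E)" "d * card (saturated d E) \<le> card E"
proof -
  have sub: "saturated d E \<subseteq> Domain E"
  proof
    fix v assume "v \<in> saturated d E"
    then have "E `` {v} \<noteq> {}" using assms(2) by (auto simp: saturated_def)
    then show "v \<in> Domain E" by auto
  qed
  have fin: "finite (Domain E)" using assms by (simp add: finite_Domain)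
  with sub show "finite (saturated d E)" using finite_subset by blast
  have "d * card (saturated d E) = (\<Sum>v\<in>saturated d E. d)" by simp
  also have "\<dots> \<le> (\<Sum>v\<in>saturated d E. card (E `` {v}))"
    by (intro sum_mono) (auto simp: saturated_def)
  also have "\<dots> \<le> (\<Sum>v\<in>Domain E. card (E `` {v}))"
    using fin sub by (intro sum_mono2) auto
  also have "\<dots> = card (SIGMA v:Domain E. E `` {v})"
    using fin assms(1) by (subst card_SigmaI) (auto simp: finite_Image)
  also have "(SIGMA v:Domain E. E `` {v}) = E" by auto
  finally show "d * card (saturated d E) \<le> card E" .
qed

section \<open>Averaging and geometric decay\<close>

text \<open>Double counting of the incidences \<open>p \<in> Q S\<close>: there are at least
  \<open>q * card I\<close> of them, and some \<open>p\<close> has at least the average share.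
  Multiplying by \<open>card P\<close> avoids division.\<close>

lemma ex_popular_point:
  fixes Q :: "'b \<Rightarrow> 'c set"
  assumes "finite I" "I \<noteq> {}" "finite P" "\<And>S. S \<in> I \<Longrightarrow> Q S \<subseteq> P" "\<And>S. S \<in> I \<Longrightarrow> q \<le> card (Q S)" "q > 0"
  obtains p where "p \<in> P" "q * card I \<le> card {S \<in> I. p \<in> Q S} * card P" "{S \<in> I. p \<in> Q S} \<noteq> {}"
proof -
  have "\<exists>p\<in>P. q * card I \<le> card {S \<in> I. p \<in> Q S} * card P"
  proof (rule ccontr)
    assume "\<not> ?thesis"
    then have lt: "card {S \<in> I. p \<in> Q S} * card P < q * card I" if "p \<in> P" for p
      using that by (auto simp: not_le)
    obtain S where "S \<in> I" using assms(2) by auto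
    then have "P \<noteq> {}" using assms(4,5)[of S] assms(6) by auto
    have "(\<Sum>S\<in>I. card (Q S)) = (\<Sum>S\<in>I. \<Sum>p\<in>P. if p \<in> Q S then 1 else 0)"
      using assms(3,4) by (intro sum.cong) (auto simp: sum.If_cases Int_absorb1)
    also have "\<dots> = (\<Sum>p\<in>P. \<Sum>S\<in>I. if p \<in> Q S then 1 else 0)" by (rule sum.swap)
    also have "\<dots> = (\<Sum>p\<in>P. card {S \<in> I. p \<in> Q S})"
      using assms(1) by (intro sum.cong) (auto simp: sum.If_cases Int_def)
    finally have "card P * (\<Sum>S\<in>I. card (Q S)) = (\<Sum>p\<in>P. card {S \<in> I. p \<in> Q S} * card P)"
      by (simp add: sum_distrib_left mult.commute)
    also have "\<dots> < (\<Sum>p\<in>P. q * card I)"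
      using \<open>P \<noteq> {}\<close> assms(3) lt by (intro sum_strict_mono) auto
    also have "\<dots> = card P * (\<Sum>S\<in>I. q)" by simp
    also have "\<dots> \<le> card P * (\<Sum>S\<in>I. card (Q S))"
      using assms(5) by (intro mult_le_mono sum_mono) auto
    finally show False by simp
  qed
  then obtain p where p: "p \<in> P" "q * card I \<le> card {S \<in> I. p \<in> Q S} * card P" by auto
  moreover have "q * card I > 0" using assms(1,2,6) by (simp add: card_gt_0_iff)
  ultimately have "card {S \<in> I. p \<in> Q S} \<noteq> 0" by (metis less_le_not_le mult_0)
  then have "{S \<in> I. p \<in> Q S} \<noteq> {}" by (metis card.empty)
  then show ?thesis using that p by blast
qed

definition independent_subsets :: "nat \<Rightarrow> 'a set \<Rightarrow> 'a rel \<Rightarrow> 'a set set" where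
  "independent_subsets s R E = {S. S \<subseteq> R \<and> card S = s \<and> S \<times> S \<inter> E = {}}"

text \<open>Bernoulli's inequality for \<open>1 / q = 1 + 1 / (C - 1)\<close> gives
  \<open>q ^ C < 1 / 2\<close>, so each block of \<open>C\<close> factors more than cancels one
  factor 2.\<close>

lemma geometric_decay:
  fixes C n :: nat
  assumes "C \<ge> 2" "n > 0"
  shows "2 ^ n * (1 - 1 / real C) ^ (C * n) < 1"
proof -
  define q where "q = 1 - 1 / real C"
  have q: "q > 0" "q < 1" using assms by (auto simp: q_def)
  have "1 + real C * (1 / (real C - 1)) \<le> (1 + 1 / (real C - 1)) ^ C"
    using assms by (intro Bernoulli_inequality) (auto simp: field_simps)
  also have "1 + 1 / (real C - 1) = 1 / q"
    using assms by (simp add: q_def field_simps)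
  finally have "1 + real C * (1 / (real C - 1)) \<le> 1 / q ^ C" by (simp add: power_one_over)
  moreover have "real C * (1 / (real C - 1)) > 1" using assms by (simp add: field_simps)
  ultimately have "2 < 1 / q ^ C" by linarith
  then have lt: "2 * q ^ C < 1" using q by (simp add: field_simps)
  have "2 ^ n * q ^ (C * n) = (2 * q ^ C) ^ n" by (simp add: power_mult_distrib power_mult)
  moreover have "(2 * q ^ C) ^ n < 1"
    using lt q assms(2) by (intro power_less_one_iff[THEN iffD2]) auto
  ultimately show ?thesis by (simp add: q_def)
qed

section \<open>The greedy choice of edges\<close>

text \<open>\<open>M\<close> is a budget of arcs. As long as it is respected,
  \<open>2 * M \<le> d * s\<close> leaves at most \<open>s / 2\<close> saturated vertices, and the
  choice of \<open>s\<close> makes every ball at most \<open>s / 4\<close>. The budget covers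
  \<open>E0\<close>, \<open>8 * c\<^sup>2 * card R\<close> edges that destroy independent sets and
  \<open>k * card R\<close> edges that raise degrees, at two arcs each.\<close>

locale greedy_extension =
  fixes k d c s M :: nat and R :: "'a set" and E0 :: "'a rel"
  assumes finite_R: "finite R" and finite_E0: "finite E0"
    and k: "k \<ge> 2" and d: "d \<ge> k" and c: "c \<ge> 1"
    and s: "s = 4 * (k * d ^ k)" and card_R: "card R = c * s"
    and M: "2 * M \<le> d * s" "card E0 + 2 * (8 * c\<^sup>2 * card R) + 2 * (k * card R) \<le> M"
    and sym_E0: "sym E0" and irrefl_E0: "irrefl E0" and girth_E0: "no_short_cycle k E0"
    and degree_E0: "\<And>v. card (E0 `` {v}) \<le> d"
begin

text \<open>The invariant of the greedy process. Confining new edges to \<open>R\<close> later keeps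
  the neighbourhoods of the centers as they are in \<open>E0\<close>.\<close>

definition admissible :: "'a rel \<Rightarrow> bool" where
  "admissible E \<longleftrightarrow> E0 \<subseteq> E \<and> E \<subseteq> E0 \<union> R \<times> R \<and> sym E \<and> irrefl E \<and> no_short_cycle k E
     \<and> (\<forall>v. card (E `` {v}) \<le> d)"

lemma admissible_finite: "admissible E \<Longrightarrow> finite E"
  using finite_R finite_E0 finite_subset[of E "E0 \<union> R \<times> R"] by (auto simp: admissible_def)

lemma admissible_add_edge:
  assumes E: "admissible E" and ab: "a \<in> R" "b \<in> R" "a \<notin> saturated d E" "b \<notin> saturated d E"
    "b \<notin> near k E a"
  shows "admissible (add_edge a b E)" "card (add_edge a b E) \<le> card E + 2"
    "card (add_edge a b E `` {a}) = Suc (card (E `` {a}))"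
proof -
  have fin: "finite E" using E by (rule admissible_finite)
  have "(a, b) \<notin> E ^^ l" if "l < k" for l
    using ab(5) that by (auto simp: near_def)
  \<comment> \<open>Walks of length 0 and 1 count as short because \<open>k \<ge> 2\<close>.\<close>
  from this[of 0] this[of 1] have ne: "a \<noteq> b" "(a, b) \<notin> E" using k by auto
  have img: "add_edge a b E `` {v} =
    (if v = a then insert b (E `` {v}) else if v = b then insert a (E `` {v}) else E `` {v})" for v
    using ne by (auto simp: add_edge_def)
  have "card (add_edge a b E `` {v}) \<le> d" for v
  proof (cases "v = a \<or> v = b")
    case True
    have "card (add_edge a b E `` {v}) \<le> Suc (card (E `` {v}))"
      unfolding img by (auto simp: card_insert_if fin finite_Image)
    also have "\<dots> \<le> d" using True ab(3,4) by (auto simp: saturated_def)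
    finally show ?thesis .
  qed (use E in \<open>simp add: img admissible_def\<close>)
  moreover have "no_short_cycle k (add_edge a b E)"
    using E ab(5) by (intro no_short_cycle_add_edge) (auto simp: admissible_def)
  moreover have "sym (add_edge a b E)"
    using E unfolding add_edge_def admissible_def by (intro sym_Un) (auto intro: symI)
  moreover have "irrefl (add_edge a b E)"
    using E ne by (simp add: admissible_def add_edge_def irrefl_def)
  moreover have "E0 \<subseteq> add_edge a b E" "add_edge a b E \<subseteq> E0 \<union> R \<times> R"
    using E ab(1,2) unfolding admissible_def add_edge_def by blast+
  ultimately show "admissible (add_edge a b E)"
    unfolding admissible_def by blast
  show "card (add_edge a b E) \<le> card E + 2"
    using card_Un_le[of E "{(a, b), (b, a)}"] ne unfolding add_edge_def by simp
  show "card (add_edge a b E `` {a}) = Suc (card (E `` {a}))"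
    using ne fin by (simp add: img finite_Image)
qed

lemma saturated_small:
  assumes "admissible E" "card E \<le> M"
  shows "finite (saturated d E)" "2 * card (saturated d E) \<le> s"
proof -
  have "d \<ge> 1" using d k by simp
  note sat = card_saturated[OF admissible_finite[OF assms(1)] this]
  show "finite (saturated d E)" by (rule sat)
  have "d * (2 * card (saturated d E)) \<le> d * s" using sat(2) assms(2) M(1) by linarith
  then show "2 * card (saturated d E) \<le> s" using \<open>d \<ge> 1\<close> by simp
qed

lemma near_small:
  assumes "admissible E"
  shows "finite (near k E a)" "4 * card (near k E a) \<le> s"
  using near_bound[OF admissible_finite[OF assms], of d k a] assms d k
  by (auto simp: admissible_def s)

lemma s_pos: "s \<ge> 4" using k d by (simp add: s)

text \<open>The forbidden vertices number at most \<open>s / 2 + s / 4\<close>, which is less than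
  \<open>s \<le> card R\<close>.\<close>

lemma ex_far_unsaturated:
  assumes E: "admissible E" "card E \<le> M"
  obtains w where "w \<in> R" "w \<notin> saturated d E" "w \<notin> near k E a"
proof -
  have "s \<le> card R" using c by (simp add: card_R)
  moreover have "card (saturated d E \<union> near k E a) < s"
    using card_Un_le[of "saturated d E" "near k E a"] saturated_small[OF E] near_small[OF E(1), of a] s_pos
    by linarith
  ultimately have "\<not> R \<subseteq> saturated d E \<union> near k E a"
    using card_mono[of "saturated d E \<union> near k E a" R] saturated_small[OF E] near_small[OF E(1), of a]
    by auto
  then show ?thesis using that by auto
qed

lemma finite_independent_subsets: "finite (independent_subsets s R E)"
  using finite_R by (auto simp: independent_subsets_def intro: finite_subset[of _ "Pow R"])

text \<open>Every independent \<open>s\<close>-set contains at least \<open>s\<^sup>2 / 8\<close> of the \<open>(c * s)\<^sup>2\<close> ordered pairs as pairs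
  that may be joined, so that joining the most popular pair destroys a fraction \<open>1 / (8 * c\<^sup>2)\<close> of
  these sets.\<close>

lemma ex_killing_edge:
  assumes E: "admissible E" "card E \<le> M" and ne: "independent_subsets s R E \<noteq> {}"
  obtains a b where "admissible (add_edge a b E)" "card (add_edge a b E) \<le> card E + 2"
    "real (card (independent_subsets s R (add_edge a b E)))
       \<le> (1 - 1 / real (8 * c\<^sup>2)) * real (card (independent_subsets s R E))"
proof -
  define B where "B = k * d ^ k"
  have sB: "s = 4 * B" by (simp add: s B_def)
  have B: "B > 0" using s_pos sB by simp
  let ?I = "independent_subsets s R E"
  let ?T = "saturated d E"
  define Q where "Q S = (SIGMA a : S - ?T. S - ?T - near k E a)" for S
  have Q: "Q S \<subseteq> R \<times> R" "2 * B * B \<le> card (Q S)" if "S \<in> ?I" for S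
  proof -
    have S: "S \<subseteq> R" "card S = s" using that by (auto simp: independent_subsets_def)
    show "Q S \<subseteq> R \<times> R" using S by (auto simp: Q_def)
    have fin: "finite S" using S finite_R finite_subset by auto
    have c1: "2 * B \<le> card (S - ?T)"
      using diff_card_le_card_Diff[of ?T S] saturated_small[OF E] S(2) sB by linarith
    have c2: "B \<le> card (S - ?T - near k E a)" for a
      using diff_card_le_card_Diff[of "near k E a" "S - ?T"] near_small[OF E(1), of a] c1 sB by linarith
    have "2 * B * B \<le> card (S - ?T) * B" using c1 by simp
    also have "\<dots> = (\<Sum>a\<in>S - ?T. B)" by simp
    also have "\<dots> \<le> (\<Sum>a\<in>S - ?T. card (S - ?T - near k E a))" using c2 by (intro sum_mono) auto
    also have "\<dots> = card (Q S)" unfolding Q_def using fin by (subst card_SigmaI) auto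
    finally show "2 * B * B \<le> card (Q S)" .
  qed
  obtain p where p: "p \<in> R \<times> R" "2 * B * B * card ?I \<le> card {S \<in> ?I. p \<in> Q S} * card (R \<times> R)"
    "{S \<in> ?I. p \<in> Q S} \<noteq> {}"
    using ex_popular_point[OF finite_independent_subsets ne, of "R \<times> R" Q "2 * B * B"] Q B finite_R by auto
  obtain a b where pab: "p = (a, b)" by force
  let ?H = "{S \<in> ?I. p \<in> Q S}" and ?E' = "add_edge a b E"
  have ab: "a \<in> R" "b \<in> R" "a \<notin> ?T" "b \<notin> ?T" "b \<notin> near k E a"
    using p(1,3) by (auto simp: Q_def pab)
  \<comment> \<open>With \<open>s = 4 * B\<close> there are
    \<open>16 * c\<^sup>2 * B\<^sup>2\<close> pairs in \<open>R \<times> R\<close>; dividing by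
    \<open>2 * B\<^sup>2\<close> leaves the factor \<open>8 * c\<^sup>2\<close>.\<close>
  have "2 * B * B * card ?I \<le> 2 * B * B * (8 * c\<^sup>2 * card ?H)"
    using p(2) by (simp add: card_cartesian_product card_R sB power2_eq_square algebra_simps)
  then have H: "card ?I \<le> 8 * c\<^sup>2 * card ?H" using B by simp
  have "independent_subsets s R ?E' \<subseteq> ?I - ?H"
    by (auto simp: independent_subsets_def add_edge_def Q_def pab)
  then have "card (independent_subsets s R ?E') \<le> card ?I - card ?H"
    using card_mono[of "?I - ?H"] finite_independent_subsets[of E]
    by (subst card_Diff_subset[symmetric]) auto
  moreover have "card ?H \<le> card ?I" using finite_independent_subsets by (intro card_mono) auto
  ultimately have "real (card (independent_subsets s R ?E')) \<le> real (card ?I) - real (card ?H)" by linarith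
  also have "\<dots> \<le> (1 - 1 / real (8 * c\<^sup>2)) * real (card ?I)"
  proof -
    have "real (card ?I) \<le> real (8 * c\<^sup>2) * real (card ?H)"
      using H by (metis of_nat_le_iff of_nat_mult)
    then have "real (card ?I) / real (8 * c\<^sup>2) \<le> real (card ?H)"
      using c by (subst pos_divide_le_eq) (auto simp: mult.commute)
    then show ?thesis by (simp add: left_diff_distrib)
  qed
  finally show ?thesis using that admissible_add_edge(1,2)[OF E(1) ab] by blast
qed

lemma admissible_E0: "admissible E0"
  using sym_E0 irrefl_E0 girth_E0 degree_E0 by (auto simp: admissible_def)

text \<open>Induction on the number \<open>t\<close> of greedy steps, starting from at most
  \<open>2 ^ card R\<close> sets.\<close>

lemma ex_few_independent_subsets:
  assumes "card E0 + 2 * t \<le> M"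
  shows "\<exists>E. admissible E \<and> card E \<le> card E0 + 2 * t \<and>
    real (card (independent_subsets s R E)) \<le> 2 ^ card R * (1 - 1 / real (8 * c\<^sup>2)) ^ t"
  using assms
proof (induction t)
  case 0
  have "card (independent_subsets s R E0) \<le> card (Pow R)"
    using finite_R by (intro card_mono) (auto simp: independent_subsets_def)
  then have "real (card (independent_subsets s R E0)) \<le> real (2 ^ card R)"
    using finite_R by (simp add: card_Pow)
  then show ?case using admissible_E0 by (intro exI[of _ E0]) simp
next
  case (Suc t)
  let ?q = "1 - 1 / real (8 * c\<^sup>2)"
  have "1 \<le> 8 * c\<^sup>2" using c by (simp add: Suc_le_eq)
  then have "1 \<le> real (8 * c\<^sup>2)" by linarith
  then have q: "0 \<le> ?q" using c by (subst diff_ge_0_iff_ge) (simp add: divide_le_eq_1)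
  have "card E0 + 2 * t \<le> M" using Suc.prems by simp
  from Suc.IH[OF this] obtain E where E: "admissible E" "card E \<le> card E0 + 2 * t"
    "real (card (independent_subsets s R E)) \<le> 2 ^ card R * ?q ^ t"
    by blast
  show ?case
  proof (cases "independent_subsets s R E = {}")
    \<comment> \<open>With no independent set left, \<open>E\<close> is kept: the bound is still
      non-negative.\<close>
    case True
    have "0 \<le> 2 ^ card R * ?q ^ Suc t" using q by (intro mult_nonneg_nonneg zero_le_power) auto
    moreover have "real (card (independent_subsets s R E)) = 0" using True by simp
    ultimately have "real (card (independent_subsets s R E)) \<le> 2 ^ card R * ?q ^ Suc t" by linarith
    moreover have "card E \<le> card E0 + 2 * Suc t" using E(2) by simp
    ultimately show ?thesis using E(1) by blast
  next
    case False
    have "card E \<le> M" using E(2) Suc.prems by simp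
    from ex_killing_edge[OF E(1) this False]
    obtain a b where ab: "admissible (add_edge a b E)" "card (add_edge a b E) \<le> card E + 2"
      "real (card (independent_subsets s R (add_edge a b E))) \<le> ?q * real (card (independent_subsets s R E))"
      by blast
    have "?q * real (card (independent_subsets s R E)) \<le> ?q * (2 ^ card R * ?q ^ t)"
      using E(3) q by (rule mult_left_mono)
    also have "\<dots> = 2 ^ card R * ?q ^ Suc t" by simp
    finally have "real (card (independent_subsets s R (add_edge a b E))) \<le> 2 ^ card R * ?q ^ Suc t"
      using ab(3) by linarith
    moreover have "card (add_edge a b E) \<le> card E0 + 2 * Suc t" using ab(2) E(2) by simp
    ultimately show ?thesis using ab(1) by blast
  qed
qed

lemma ex_no_independent_subsets:
  obtains E where "admissible E" "card E + 2 * (k * card R) \<le> M" "independent_subsets s R E = {}"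
proof -
  let ?t = "8 * c\<^sup>2 * card R"
  obtain E where E: "admissible E" "card E \<le> card E0 + 2 * ?t"
    "real (card (independent_subsets s R E)) \<le> 2 ^ card R * (1 - 1 / real (8 * c\<^sup>2)) ^ ?t"
    using ex_few_independent_subsets[of ?t] M(2) by auto
  have c2: "8 * c\<^sup>2 \<ge> 2" using c by (simp add: Suc_le_eq)
  have "card R > 0" using card_R c s_pos by simp
  from geometric_decay[OF c2 this] have "real (card (independent_subsets s R E)) < 1"
    using E(3) by linarith
  then have "independent_subsets s R E = {}" using finite_independent_subsets by auto
  then show ?thesis using that E(1,2) M(2) by auto
qed

text \<open>Induction on the total degree deficit. An edge at a deficient vertex costs at most two
  arcs and lowers the deficit by at least one, so the budget inequality persists.\<close>

lemma ex_large_degree: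
  assumes "admissible E" "card E + 2 * (\<Sum>v\<in>R. k - card (E `` {v})) \<le> M"
  shows "\<exists>E'. E \<subseteq> E' \<and> admissible E' \<and> (\<forall>v\<in>R. k \<le> card (E' `` {v}))"
  using assms
proof (induction "\<Sum>v\<in>R. k - card (E `` {v})" arbitrary: E rule: less_induct)
  case less
  show ?case
  proof (cases "\<forall>v\<in>R. k \<le> card (E `` {v})")
    case False
    then obtain v where v: "v \<in> R" "card (E `` {v}) < k" by (auto simp: not_le)
    have "card E \<le> M" using less.prems by simp
    then obtain w where w: "w \<in> R" "w \<notin> saturated d E" "w \<notin> near k E v"
      using ex_far_unsaturated[OF less.prems(1)] by metis
    let ?E' = "add_edge v w E"
    have "v \<notin> saturated d E" using v d by (auto simp: saturated_def)
    note add = admissible_add_edge[OF less.prems(1) v(1) w(1) this w(2,3)]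
    have "card (E `` {x}) \<le> card (?E' `` {x})" for x
      using admissible_finite[OF add(1)] by (intro card_mono finite_Image) (auto simp: add_edge_def)
    then have sum: "(\<Sum>x\<in>R. k - card (?E' `` {x})) < (\<Sum>x\<in>R. k - card (E `` {x}))"
      using v add(3) finite_R by (intro sum_strict_mono_ex1) (auto intro!: diff_le_mono2 bexI[of _ v])
    then have "card ?E' + 2 * (\<Sum>x\<in>R. k - card (?E' `` {x})) \<le> M"
      using less.prems(2) add(2) by linarith
    from less.hyps[OF sum add(1) this] show ?thesis
      by (auto simp: add_edge_def)
  qed (use less.prems in auto)
qed

theorem ex_extension:
  obtains E where "admissible E" "independent_subsets s R E = {}" "\<forall>v\<in>R. k \<le> card (E `` {v})"
proof -
  obtain E where E: "admissible E" "card E + 2 * (k * card R) \<le> M" "independent_subsets s R E = {}"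
    by (rule ex_no_independent_subsets)
  have "(\<Sum>v\<in>R. k - card (E `` {v})) \<le> (\<Sum>v\<in>R. k)" by (intro sum_mono) auto
  then have "card E + 2 * (\<Sum>v\<in>R. k - card (E `` {v})) \<le> M" using E(2) by (simp add: mult.commute)
  then obtain E' where "E \<subseteq> E'" "admissible E'" "\<forall>v\<in>R. k \<le> card (E' `` {v})"
    using ex_large_degree[OF E(1)] by auto
  moreover from this(1) have "independent_subsets s R E' = {}"
    using E(3) by (fastforce simp: independent_subsets_def)
  ultimately show ?thesis using that by blast
qed

end

section \<open>Joining the components\<close>

text \<open>An inclusion-maximal extension inside \<open>R\<close> without short cycles works: if
  \<open>u\<close> and \<open>v\<close> were in different components, the edge between them would
  close no cycle, contradicting maximality.\<close>

lemma ex_connected_extension: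
  fixes E :: "'a rel"
  assumes "finite R" "finite E" "sym E" "irrefl E" "no_short_cycle k E"
  obtains E' where "E \<subseteq> E'" "E' \<subseteq> E \<union> R \<times> R" "sym E'" "irrefl E'" "no_short_cycle k E'"
    "\<And>u v. u \<in> R \<Longrightarrow> v \<in> R \<Longrightarrow> (u, v) \<in> E'\<^sup>*"
proof -
  define A where
    "A = {E'. E \<subseteq> E' \<and> E' \<subseteq> E \<union> R \<times> R \<and> sym E' \<and> irrefl E' \<and> no_short_cycle k E'}"
  have "finite A"
    using assms(1,2) by (intro finite_subset[of A "Pow (E \<union> R \<times> R)"]) (auto simp: A_def)
  moreover have "E \<in> A" using assms by (auto simp: A_def)
  ultimately obtain E' where E': "E' \<in> A" "\<And>F. F \<in> A \<Longrightarrow> E' \<subseteq> F \<Longrightarrow> F = E'"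
    using finite_has_maximal[of A] by blast
  have "(u, v) \<in> E'\<^sup>*" if uv: "u \<in> R" "v \<in> R" for u v
  proof (rule ccontr)
    assume no: "(u, v) \<notin> E'\<^sup>*"
    then have ne: "u \<noteq> v" "(u, v) \<notin> E'" by auto
    have "v \<notin> near k E' u" using no by (auto simp: near_def dest: relpow_imp_rtrancl)
    then have "no_short_cycle k (add_edge u v E')"
      using E'(1) by (intro no_short_cycle_add_edge) (auto simp: A_def)
    moreover have "sym (add_edge u v E')"
      using E'(1) unfolding add_edge_def A_def by (intro sym_Un) (auto intro: symI)
    moreover have "irrefl (add_edge u v E')"
      using E'(1) ne by (simp add: A_def add_edge_def irrefl_def)
    moreover have "E \<subseteq> add_edge u v E'" "add_edge u v E' \<subseteq> E \<union> R \<times> R"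
      using E'(1) uv unfolding A_def add_edge_def by blast+
    ultimately have "add_edge u v E' \<in> A" unfolding A_def by blast
    then have "add_edge u v E' = E'" by (rule E'(2)) (auto simp: add_edge_def)
    then show False using ne by (auto simp: add_edge_def)
  qed
  then show ?thesis using that E'(1) by (auto simp: A_def)
qed

section \<open>Disjoint stars\<close>

definition stars :: "('a \<Rightarrow> 'a) \<Rightarrow> 'a set \<Rightarrow> 'a rel" where
  "stars c R = (\<lambda>y. (c y, y)) ` R \<union> (\<lambda>y. (y, c y)) ` R"

lemma sym_stars: "sym (stars c R)"
  by (auto simp: stars_def intro!: symI)

lemma card_stars: "finite R \<Longrightarrow> card (stars c R) \<le> 2 * card R"
  unfolding stars_def
  using card_Un_le[of "(\<lambda>y. (c y, y)) ` R" "(\<lambda>y. (y, c y)) ` R"]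
    card_image_le[of R "\<lambda>y. (c y, y)"] card_image_le[of R "\<lambda>y. (y, c y)"] by simp

text \<open>Every edge ends in a leaf whose only neighbour is its center. Without that edge the leaf
  is isolated, so no walk of any length joins the two ends.\<close>

lemma no_short_cycle_stars:
  assumes "c ` R \<inter> R = {}"
  shows "no_short_cycle k (stars c R)"
  unfolding no_short_cycle_def
proof (intro allI impI notI, elim conjE)
  fix u v l
  assume uv: "(u, v) \<in> stars c R" and walk: "(u, v) \<in> (stars c R - {(u, v), (v, u)}) ^^ l"
  have "u \<noteq> v" using uv assms by (auto simp: stars_def)
  with walk obtain m where m: "l = Suc m" by (cases l) auto
  consider "v \<in> R" "u = c v" | "u \<in> R" "v = c u" using uv by (auto simp: stars_def)
  then show False
  proof cases
    case 1
    from walk obtain w where "(w, v) \<in> stars c R - {(u, v), (v, u)}" unfolding m by auto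
    with 1 assms show False by (auto simp: stars_def)
  next
    case 2
    from walk obtain w where "(u, w) \<in> stars c R - {(u, v), (v, u)}"
      unfolding m by (meson relpow_Suc_D2)
    with 2 assms show False by (auto simp: stars_def)
  qed
qed

section \<open>From relations to graphs\<close>

lemma pcas_imp_relpow: "pcas u p v \<Longrightarrow> set p \<subseteq> E \<Longrightarrow> (u, v) \<in> E ^^ length p"
proof (induction p arbitrary: u)
  case (Cons e p)
  then have "(snd e, v) \<in> E ^^ length p" "(u, snd e) \<in> E" by auto
  then show ?case by (simp only: length_Cons relpow_Suc_I2)
qed auto

lemma relpow_imp_pcas: "(u, v) \<in> E ^^ l \<Longrightarrow> \<exists>p. pcas u p v \<and> set p \<subseteq> E \<and> length p = l"
proof (induction l arbitrary: u)
  case (Suc l)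
  then obtain w where w: "(u, w) \<in> E" "(w, v) \<in> E ^^ l" by (meson relpow_Suc_D2)
  from Suc.IH[OF w(2)] obtain p where "pcas w p v" "set p \<subseteq> E" "length p = l" by blast
  with w(1) show ?case by (intro exI[of _ "(u, w) # p"]) auto
qed auto

lemma pcas_snoc: "pcas u (p @ [e]) v \<longleftrightarrow> pcas u p (fst e) \<and> snd e = v"
  by (induction p arbitrary: u) auto

lemma pawalk_verts_conv: "pcas u p v \<Longrightarrow> pawalk_verts u p = u # map snd p"
  by (induction p arbitrary: u) auto

abbreviation graph_of :: "'a set \<Rightarrow> 'a rel \<Rightarrow> ('a, 'a \<times> 'a) pre_digraph" where
  "graph_of V E \<equiv> with_proj \<lparr>pverts = V, parcs = E\<rparr>"

lemma awalk_graph_of: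
  "pre_digraph.awalk (graph_of V E) u p v \<longleftrightarrow> u \<in> V \<and> set p \<subseteq> E \<and> pcas u p v"
  by (simp add: pre_digraph.awalk_def cas_with_proj_eq)

text \<open>Removing the first arc of a cycle leaves a walk back between its ends, one step shorter.
  It avoids that edge in both directions because the heads of the arcs are distinct.\<close>

lemma girth_graph_of:
  assumes "sym E" "no_short_cycle k E"
  shows "enat k \<le> girth (graph_of V E)"
  unfolding girth_def
proof (intro INF_greatest, clarify)
  fix p assume "pre_digraph.cycle (graph_of V E) p" and len: "3 \<le> length p"
  then obtain u where walk: "set p \<subseteq> E" "pcas u p u" and "distinct (tl (pawalk_verts u p))"
    by (auto simp: pre_digraph.cycle_def awalk_graph_of awalk_verts_with_proj_eq)
  then have dist: "distinct (map snd p)" by (simp add: pawalk_verts_conv)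
  obtain e q where p: "p = e # q" using len by (cases p) auto
  obtain v where e: "e = (u, v)" using walk(2) p by (cases e) auto
  have q: "pcas v q u" "set q \<subseteq> E" "(u, v) \<in> E" using walk by (auto simp: p e)
  have q1: "(u, v) \<notin> set q" using dist by (force simp: p e)
  obtain q' e' where q': "q = q' @ [e']" using len p by (cases q rule: rev_cases) auto
  obtain x where e': "e' = (x, u)" "pcas v q' x" using q(1) by (cases e') (auto simp: q' pcas_snoc)
  \<comment> \<open>The reversed arc could only be the last one, the only arc with head
    \<open>u\<close>. As the cycle has at least three arcs, another arc \<open>f\<close> would
    precede it inside \<open>q\<close> and share the head \<open>v\<close> with
    \<open>e\<close>.\<close>
  have q2: "(v, u) \<notin> set q"
  proof
    assume "(v, u) \<in> set q"
    then have "x = v" using dist by (force simp: p e q' e')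
    obtain r f where r: "q' = r @ [f]" using len p q' by (cases q' rule: rev_cases) auto
    then have "snd f = v" using e'(2) \<open>x = v\<close> by (simp add: pcas_snoc)
    then show False using dist by (simp add: p e q' r)
  qed
  have "(v, u) \<in> (E - {(v, u), (u, v)}) ^^ length q"
    using q q1 q2 by (intro pcas_imp_relpow) auto
  moreover have "(v, u) \<in> E" using q(3) assms(1) by (auto dest: symD)
  ultimately have "\<not> length q + 1 < k" using assms(2) unfolding no_short_cycle_def by blast
  then show "enat k \<le> enat (length p)" by (simp add: p)
qed

lemma graph_dist_le: "(u, v) \<in> E ^^ l \<Longrightarrow> u \<in> V \<Longrightarrow> graph_dist (graph_of V E) u v \<le> enat l"
proof -
  assume "(u, v) \<in> E ^^ l" "u \<in> V"
  moreover from this obtain p where "pcas u p v" "set p \<subseteq> E" "length p = l"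
    using relpow_imp_pcas by metis
  ultimately show ?thesis unfolding graph_dist_def by (intro INF_lower2[of p]) (auto simp: awalk_graph_of)
qed

lemma graph_dist_gt:
  assumes "\<And>l. l \<le> n \<Longrightarrow> (u, v) \<notin> E ^^ l"
  shows "graph_dist (graph_of V E) u v > enat n"
proof -
  \<comment> \<open>An infimum inherits only weak lower bounds, hence the passage to
    \<open>Suc n\<close>; it also covers unreachable \<open>v\<close>.\<close>
  have "enat (Suc n) \<le> graph_dist (graph_of V E) u v"
    unfolding graph_dist_def
  proof (intro INF_greatest, clarify)
    fix p assume "pre_digraph.awalk (graph_of V E) u p v"
    then have "(u, v) \<in> E ^^ length p" by (auto simp: awalk_graph_of intro: pcas_imp_relpow)
    then show "enat (Suc n) \<le> enat (length p)" using assms by (force simp: not_less_eq_eq[symmetric])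
  qed
  then show ?thesis using less_le_trans[of "enat n" "enat (Suc n)"] by simp
qed

lemma pair_graph_graph_of:
  assumes "finite V" "E \<subseteq> V \<times> V" "sym E" "irrefl E"
  shows "pair_graph \<lparr>pverts = V, parcs = E\<rparr>"
proof
  show "finite (parcs \<lparr>pverts = V, parcs = E\<rparr>)" using assms by (auto intro: finite_subset)
  show "symmetric (graph_of V E)" using assms by (simp add: symmetric_def)
qed (use assms in \<open>auto simp: irrefl_def\<close>)

lemma connected_graph_of:
  assumes "V \<noteq> {}" "E \<subseteq> V \<times> V" "\<And>u v. u \<in> V \<Longrightarrow> v \<in> V \<Longrightarrow> (u, v) \<in> E\<^sup>*"
  shows "Digraph_Component.connected (graph_of V E)"
  unfolding connected_conv
proof (intro conjI ballI)
  fix u v assume "u \<in> verts (graph_of V E)" "v \<in> verts (graph_of V E)"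
  then have uv: "u \<in> V" "v \<in> V" by auto
  then have "(u, v) \<in> rtrancl_on V E"
    using assms by (intro rtrancl_consistent_rtrancl_on) auto
  then show "(u, v) \<in> rtrancl_on (verts (graph_of V E)) ((arcs_ends (graph_of V E))\<^sup>s)"
    by (rule rtrancl_on_mono[rotated 2]) (auto simp: symcl_def)
qed (use assms in auto)

lemma out_degree_graph_of: "out_degree (graph_of V E) v = card (E `` {v})"
proof -
  have "out_arcs (graph_of V E) v = Pair v ` (E `` {v})" by (auto simp: out_arcs_def)
  then show ?thesis by (simp add: out_degree_def card_image inj_on_def)
qed

lemma min_degree_ge:
  assumes "finite V" "V \<noteq> {}" "\<And>v. v \<in> V \<Longrightarrow> k \<le> card (E `` {v})"
  shows "k \<le> min_degree (graph_of V E)"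
  using assms by (auto simp: min_degree_def out_degree_graph_of intro!: Min.boundedI)

lemma independence_number_le:
  assumes "finite V" "\<And>S. S \<subseteq> V \<Longrightarrow> S \<times> S \<inter> E = {} \<Longrightarrow> card S \<le> b"
  shows "independence_number (graph_of V E) \<le> b"
  unfolding independence_number_def
proof (rule Max.boundedI)
  have "{card S |S. independent_vertices (graph_of V E) S} \<subseteq> card ` Pow V"
    by (auto simp: independent_vertices_def)
  then show "finite {card S |S. independent_vertices (graph_of V E) S}"
    using assms(1) finite_subset by blast
  have "independent_vertices (graph_of V E) {}" by (simp add: independent_vertices_def)
  then show "{card S |S. independent_vertices (graph_of V E) S} \<noteq> {}" by blast
  fix a assume "a \<in> {card S |S. independent_vertices (graph_of V E) S}"
  then obtain S where "a = card S" "S \<subseteq> V" "\<forall>u\<in>S. \<forall>v\<in>S. (u, v) \<notin> E"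
    by (auto simp: independent_vertices_def)
  then show "a \<le> b" using assms(2)[of S] by auto
qed

text \<open>\<open>Max\<close> is meaningful only on a finite set. Connectedness makes all distances
  finite, so their sum \<open>K\<close> bounds every eccentricity and \<open>card V * K\<close>
  every weight.\<close>

lemma broadcast_weight_le:
  assumes V: "finite V" and conn: "\<And>u v. u \<in> V \<Longrightarrow> v \<in> V \<Longrightarrow> (u, v) \<in> E\<^sup>*"
    and f: "independent_broadcast (graph_of V E) f"
  shows "broadcast_weight (graph_of V E) f \<le> broadcast_independence_number (graph_of V E)"
  unfolding broadcast_independence_number_def
proof (rule Max_ge)
  let ?G = "graph_of V E"
  define K where "K = (\<Sum>(u, v)\<in>V \<times> V. the_enat (graph_dist ?G u v))"
  have "graph_dist ?G u v \<le> enat K" if uv: "u \<in> V" "v \<in> V" for u v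
  proof -
    obtain l where "(u, v) \<in> E ^^ l" using conn[OF uv] by (auto dest: rtrancl_imp_relpow)
    then have "graph_dist ?G u v \<le> enat l" using uv by (intro graph_dist_le)
    then have "graph_dist ?G u v = enat (the_enat (graph_dist ?G u v))"
      by (cases "graph_dist ?G u v") auto
    moreover have "the_enat (graph_dist ?G u v) \<le> K"
      unfolding K_def
      using member_le_sum[of "(u, v)" "V \<times> V" "\<lambda>(u, v). the_enat (graph_dist ?G u v)"] uv V by auto
    ultimately show ?thesis by (metis enat_ord_simps(1))
  qed
  then have ecc: "eccentricity ?G u \<le> enat K" if "u \<in> V" for u
    using that by (auto simp: eccentricity_def intro: SUP_least)
  have "broadcast_weight ?G g \<le> card V * K" if "independent_broadcast ?G g" for g
  proof -
    have "g x \<le> K" if "x \<in> V" for x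
      using \<open>independent_broadcast ?G g\<close> ecc[OF that] that
      by (metis enat_ord_simps(1) independent_broadcast_def order.trans with_proj_simps(1) pair_pre_digraph.select_convs(1))
    then have "sum g V \<le> (\<Sum>x\<in>V. K)" by (rule sum_mono)
    then show ?thesis by (simp add: broadcast_weight_def)
  qed
  then have "{broadcast_weight ?G f |f. independent_broadcast ?G f} \<subseteq> {..card V * K}" by auto
  then show "finite {broadcast_weight ?G f |f. independent_broadcast ?G f}"
    using finite_subset by blast
qed (use f in auto)

section \<open>The construction and its parameters\<close>

lemma ex_graph_large_broadcast:
  fixes k :: nat
  assumes k: "k \<ge> 2"
  shows "\<exists>G :: nat pair_pre_digraph.
           pair_graph G \<and> Digraph_Component.connected (with_proj G) \<and>
           girth (with_proj G) \<ge> enat k \<and>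
           min_degree (with_proj G) \<ge> k \<and>
           real (broadcast_independence_number (with_proj G))
             \<ge> 2 * (1 - 1 / real k) * real (independence_number (with_proj G))"
proof -
  \<comment> \<open>This is the ratio \<open>card R / s\<close>: there are
    \<open>(k - 1) * s\<close> centers with \<open>k\<close> leaves each.\<close>
  define c where "c = k * (k - 1)"
  \<comment> \<open>Chosen so that \<open>d * s\<close> is twice the arc budget. It depends on
    \<open>k\<close> alone, so \<open>s\<close> can be defined from it.\<close>
  define d where "d = 4 * c * (1 + 8 * c\<^sup>2 + k)"
  define s where "s = 4 * (k * d ^ k)"
  define N where "N = (k - 1) * s"
  define X where "X = {..<N}"
  define R where "R = {N..<N + k * N}"
  \<comment> \<open>The leaves of center \<open>x\<close> form the block of the \<open>k\<close>
    numbers from \<open>N + k * x\<close> on.\<close>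
  define center where "center y = (y - N) div k" for y
  define V where "V = X \<union> R"
  define E0 where "E0 = stars center R"
  have c: "c \<ge> 1" using k by (simp add: c_def)
  have dk: "d \<ge> k"
  proof -
    have "1 * k \<le> (4 * c) * (1 + 8 * c\<^sup>2 + k)" using c by (intro mult_le_mono) auto
    then show ?thesis by (simp add: d_def)
  qed
  have N: "N \<ge> 4"
  proof -
    have "1 \<le> k * d ^ k" using k dk by simp
    then have "1 * 4 \<le> (k - 1) * s" using k unfolding s_def by (intro mult_le_mono) auto
    then show ?thesis by (simp add: N_def)
  qed
  have card_R: "card R = c * s" by (simp add: R_def N_def c_def)
  have fin: "finite R" "finite X" "finite V" by (auto simp: R_def X_def V_def)
  have XR: "X \<inter> R = {}" by (auto simp: X_def R_def)
  have center: "center y \<in> X" if "y \<in> R" for y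
  proof -
    have "y - N < N * k" using that N k by (auto simp: R_def mult.commute)
    then show ?thesis by (simp add: center_def X_def less_mult_imp_div_less)
  qed
  have leaves: "{y \<in> R. center y = x} = {N + k * x..<N + k * x + k}" if "x \<in> X" for x
  proof (intro set_eqI iffI)
    fix y assume "y \<in> {y \<in> R. center y = x}"
    then have y: "N \<le> y" "x = (y - N) div k" by (auto simp: R_def center_def)
    have "k * ((y - N) div k) \<le> y - N" "y - N < k * ((y - N) div k) + k"
      using k dividend_less_times_div[of k "y - N"] by auto
    then have "N + k * x \<le> y" "y < N + k * x + k"
      using y(1) unfolding y(2)[symmetric] by linarith+
    then show "y \<in> {N + k * x..<N + k * x + k}" by simp
  next
    fix y assume y: "y \<in> {N + k * x..<N + k * x + k}"
    define j where "j = y - N - k * x"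
    have j: "y = N + (k * x + j)" "j < k" using y by (auto simp: j_def)
    have "Suc x \<le> N" using that by (simp add: X_def)
    then have "k * Suc x \<le> k * N" by (rule mult_le_mono2)
    then have "y \<in> R" using j by (simp add: R_def)
    moreover have "center y = x" using j k by (simp add: center_def)
    ultimately show "y \<in> {y \<in> R. center y = x}" by simp
  qed
  have E0_X: "E0 `` {x} = {N + k * x..<N + k * x + k}" if "x \<in> X" for x
    unfolding leaves[OF that, symmetric] using that XR center by (auto simp: E0_def stars_def)
  have E0_R: "E0 `` {y} = {center y}" if "y \<in> R" for y
    using that XR center by (auto simp: E0_def stars_def)
  have E0_sub: "E0 \<subseteq> V \<times> V" using center by (auto simp: E0_def stars_def V_def)
  have E0_deg: "card (E0 `` {v}) \<le> d" for v
  proof -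
    consider "v \<in> X" | "v \<in> R" | "v \<notin> V" by (auto simp: V_def)
    then show ?thesis
    proof cases
      case 3
      then have "E0 `` {v} = {}" using E0_sub by auto
      then show ?thesis by simp
    qed (use dk k E0_X E0_R in auto)
  qed
  \<comment> \<open>The three summands of the budget pay for the stars, the edges destroying
    independent sets and the edges raising degrees.\<close>
  interpret greedy_extension k d c s "2 * card R * (1 + 8 * c\<^sup>2 + k)" R E0
  proof
    have "center y \<noteq> y" if "y \<in> R" for y using that center[OF that] XR by auto
    then show "irrefl E0" by (force simp: irrefl_def E0_def stars_def)
    show "no_short_cycle k E0" unfolding E0_def using XR center by (intro no_short_cycle_stars) auto
    show "2 * (2 * card R * (1 + 8 * c\<^sup>2 + k)) \<le> d * s"
      by (simp add: card_R d_def algebra_simps)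
    show "card E0 + 2 * (8 * c\<^sup>2 * card R) + 2 * (k * card R) \<le> 2 * card R * (1 + 8 * c\<^sup>2 + k)"
      using card_stars[OF fin(1), of center] unfolding E0_def[symmetric] by (simp add: algebra_simps)
  qed (use fin k dk c card_R E0_deg E0_sub sym_stars[of center R] in
        \<open>auto simp: s_def E0_def intro: finite_subset\<close>)
  obtain E1 where E1: "admissible E1" "independent_subsets s R E1 = {}"
    "\<forall>v\<in>R. k \<le> card (E1 `` {v})"
    by (rule ex_extension)
  obtain E where E: "E1 \<subseteq> E" "E \<subseteq> E1 \<union> R \<times> R" "sym E" "irrefl E" "no_short_cycle k E"
    "\<And>u v. u \<in> R \<Longrightarrow> v \<in> R \<Longrightarrow> (u, v) \<in> E\<^sup>*"
    using ex_connected_extension[OF fin(1) admissible_finite[OF E1(1)], of k] E1(1)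
    unfolding admissible_def by metis
  have E0_E: "E0 \<subseteq> E" "E \<subseteq> E0 \<union> R \<times> R" using E(1,2) E1(1) by (auto simp: admissible_def)
  have E_sub: "E \<subseteq> V \<times> V" using E0_E(2) E0_sub by (auto simp: V_def)
  then have finE: "finite E" using fin by (meson finite_SigmaI finite_subset)
  \<comment> \<open>All added edges lie inside \<open>R\<close>, so a center is still adjacent to
    its own leaves only.\<close>
  have star_E: "y \<in> R \<and> center y = x" if "x \<in> X" "(x, y) \<in> E" for x y
  proof -
    have "(x, y) \<in> E0" using that XR E0_E(2) by auto
    then have "y \<in> E0 `` {x}" by auto
    then show ?thesis using E0_X[OF that(1)] leaves[OF that(1)] by auto
  qed
  have deg: "k \<le> card (E `` {v})" if "v \<in> V" for v
  proof (cases "v \<in> X")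
    case True
    have "k = card (E0 `` {v})" using E0_X[OF True] by simp
    also have "\<dots> \<le> card (E `` {v})" using finE E0_E by (intro card_mono finite_Image) auto
    finally show ?thesis .
  next
    case False
    then have "k \<le> card (E1 `` {v})" using E1(3) that by (auto simp: V_def)
    also have "\<dots> \<le> card (E `` {v})" using finE E(1) by (intro card_mono finite_Image) auto
    finally show ?thesis .
  qed
  have conn: "(u, v) \<in> E\<^sup>*" if uv: "u \<in> V" "v \<in> V" for u v
  proof -
    \<comment> \<open>Each center has a leaf as a neighbour, and any two vertices of
      \<open>R\<close> are already connected.\<close>
    have to_R: "\<exists>r\<in>R. (x, r) \<in> E\<^sup>* \<and> (r, x) \<in> E\<^sup>*" if "x \<in> V" for x
    proof (cases "x \<in> X")
      case True
      have "E `` {x} \<noteq> {}" using deg[OF that] k by auto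
      then obtain r where r: "(x, r) \<in> E" by auto
      then have "(r, x) \<in> E" using E(3) by (auto dest: symD)
      then show ?thesis using r star_E[OF True r] by auto
    qed (use that in \<open>auto simp: V_def\<close>)
    from to_R[OF uv(1)] to_R[OF uv(2)] show ?thesis
      using E(6) by (meson rtrancl_trans)
  qed
  have "0 \<in> V" using N by (simp add: V_def X_def)
  then have ne: "V \<noteq> {}" by blast
  let ?G = "graph_of V E"
  \<comment> \<open>Centers are pairwise non-adjacent, and a common neighbour would be a leaf with
    two centers.\<close>
  have dist: "graph_dist ?G x y > enat 2" if xy: "x \<in> X" "y \<in> X" "x \<noteq> y" for x y
  proof (rule graph_dist_gt)
    fix l :: nat assume "l \<le> 2"
    then consider "l = 0" | "l = 1" | "l = Suc 1" by linarith
    then show "(x, y) \<notin> E ^^ l"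
    proof cases
      case 2
      then show ?thesis using star_E[OF xy(1)] xy(2) XR by auto
    next
      case 3
      show ?thesis
      proof
        assume "(x, y) \<in> E ^^ l"
        then obtain z where z: "(x, z) \<in> E" "(z, y) \<in> E" using 3 by auto
        then have "(y, z) \<in> E" using E(3) by (auto dest: symD)
        then show False using star_E[OF xy(1) z(1)] star_E[OF xy(2)] xy(3) by blast
      qed
    qed (use xy in auto)
  qed
  define f :: "nat \<Rightarrow> nat" where "f x = (if x \<in> X then 2 else 0)" for x
  have "independent_broadcast ?G f"
    unfolding independent_broadcast_def
  proof (intro conjI ballI impI)
    fix x assume "x \<in> verts ?G"
    show "enat (f x) \<le> eccentricity ?G x"
    proof (cases "x \<in> X")
      case True
      \<comment> \<open>A second center, present since \<open>N \<ge> 4\<close>, witnesses that the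
        eccentricity is at least 2.\<close>
      obtain y where y: "y \<in> X" "y \<noteq> x"
        using N that[of 0] that[of 1] by (cases "x = 0") (auto simp: X_def)
      have "enat 2 \<le> graph_dist ?G x y" using dist[OF True y(1)] y(2) by auto
      also have "\<dots> \<le> eccentricity ?G x"
        unfolding eccentricity_def using y by (intro SUP_upper) (auto simp: V_def)
      finally show ?thesis using True by (simp add: f_def)
    qed (simp add: f_def zero_enat_def[symmetric])
  next
    fix x y assume "x \<noteq> y \<and> 0 < f x \<and> 0 < f y"
    then have "x \<in> X" "y \<in> X" "x \<noteq> y" by (auto simp: f_def split: if_splits)
    then show "enat (max (f x) (f y)) < graph_dist ?G x y" using dist by (simp add: f_def)
  qed
  then have "broadcast_weight ?G f \<le> broadcast_independence_number ?G"
    using fin(3) conn by (intro broadcast_weight_le)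
  moreover have "broadcast_weight ?G f = 2 * N"
  proof -
    have "broadcast_weight ?G f = (\<Sum>x\<in>V. if x \<in> X then 2 else 0)"
      by (simp add: broadcast_weight_def f_def)
    also have "\<dots> = (\<Sum>x\<in>X. 2)" using fin by (subst sum.If_cases) (auto simp: V_def Int_absorb1)
    finally show ?thesis by (simp add: X_def)
  qed
  ultimately have weight: "2 * N \<le> broadcast_independence_number ?G" by simp
  have "independence_number ?G \<le> N + s"
  proof (rule independence_number_le[OF fin(3)])
    fix S assume S: "S \<subseteq> V" "S \<times> S \<inter> E = {}"
    \<comment> \<open>Otherwise some \<open>s\<close>-subset of \<open>S \<inter> R\<close> would be
      independent already in \<open>E1\<close>.\<close>
    have "card (S \<inter> R) < s"
    proof (rule ccontr)
      assume "\<not> ?thesis"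
      then obtain T where "T \<subseteq> S \<inter> R" "card T = s"
        by (metis not_less obtain_subset_with_card_n)
      then have "T \<in> independent_subsets s R E1"
        using S(2) E(1) unfolding independent_subsets_def by blast
      then show False using E1(2) by simp
    qed
    moreover have "card (S \<inter> X) \<le> N" using card_mono[OF fin(2), of "S \<inter> X"] by (simp add: X_def)
    moreover have "card S \<le> card (S \<inter> X) + card (S \<inter> R)"
      using card_Un_le[of "S \<inter> X" "S \<inter> R"] S(1) by (simp add: V_def Int_Un_distrib[symmetric] Int_absorb2)
    ultimately show "card S \<le> N + s" by simp
  qed
  moreover have "0 \<le> 2 * (1 - 1 / real k)" using k by (simp add: field_simps)
  ultimately have "2 * (1 - 1 / real k) * real (independence_number ?G) \<le> 2 * (1 - 1 / real k) * real (N + s)"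
    by (intro mult_left_mono of_nat_mono)
  also have "\<dots> = real (2 * N)"
  proof -
    \<comment> \<open>The choice \<open>N = (k - 1) * s\<close> makes the factor
      \<open>1 - 1 / k\<close> exactly \<open>N / (N + s)\<close>.\<close>
    have "N + s = k * s" using k by (cases k) (auto simp: N_def)
    then have "2 * (1 - 1 / real k) * real (N + s) = 2 * (real k - 1) * real s"
      using k by (simp add: field_simps)
    then show ?thesis using k by (simp add: N_def of_nat_diff)
  qed
  also have "\<dots> \<le> real (broadcast_independence_number ?G)" using weight by (rule of_nat_mono)
  finally have "2 * (1 - 1 / real k) * real (independence_number ?G) \<le> real (broadcast_independence_number ?G)" .
  then show ?thesis
    using pair_graph_graph_of[OF fin(3) E_sub E(3,4)] connected_graph_of[OF ne E_sub conn]
      girth_graph_of[OF E(3,5)] min_degree_ge[OF fin(3) ne deg]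
    by blast
qed

theorem theorem2:
  fixes k :: nat
  assumes "k \<ge> 1"
  shows "\<exists>G :: nat pair_pre_digraph.
           pair_graph G \<and> Digraph_Component.connected (with_proj G) \<and>
           girth (with_proj G) \<ge> enat k \<and>
           min_degree (with_proj G) \<ge> k \<and>
           real (broadcast_independence_number (with_proj G))
             \<ge> 2 * (1 - 1 / real k) * real (independence_number (with_proj G))"
proof -
  \<comment> \<open>The construction assumes \<open>k \<ge> 2\<close>. All claims are monotone in
    \<open>k\<close>, so the graph for 2 also serves for 1.\<close>
  let ?K = "max k 2"
  obtain G :: "nat pair_pre_digraph" where G: "pair_graph G" "Digraph_Component.connected (with_proj G)"
    "enat ?K \<le> girth (with_proj G)" "?K \<le> min_degree (with_proj G)"
    "2 * (1 - 1 / real ?K) * real (independence_number (with_proj G))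
      \<le> real (broadcast_independence_number (with_proj G))"
    using ex_graph_large_broadcast[of ?K] by auto
  have "1 / real ?K \<le> 1 / real k" using assms by (intro divide_left_mono) auto
  then have "2 * (1 - 1 / real k) * real (independence_number (with_proj G))
    \<le> 2 * (1 - 1 / real ?K) * real (independence_number (with_proj G))"
    by (intro mult_right_mono) auto
  moreover have "enat k \<le> girth (with_proj G)"
    using G(3) by (rule order.trans[rotated]) simp
  ultimately show ?thesis using G by (intro exI[of _ G]) auto
qed

end
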